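(* Let $X$ be the instantaneous channel power of Rician fading with parameter $K$, i.e. the nonnegative random variable (with $\sqrt{X}$ Rice distributed with parameter $K$) whose Laplace transform is $$\mathbb{E}[e^{-sX}]=\frac{1+K}{1+K+s}\exp\left(-\frac{Ks}{1+K+s}\right),\qquad s\ge 0 .$$ Then the Laplace exponent $\gamma_X(s)=-\log\mathbb{E}[e^{-sX}]$ is a Bernstein function, of the form $\gamma_X(x)=\int_0^\infty(1-e^{-sx})\,\tau(s)\,ds$ with $$\tau(s)=e^{-(1+K)s}\left(K(1+K)+\frac1s\right),$$ and consequently $X$ is infinitely divisible; but $X$ is not a generalized gamma convolution.
   Context: A nonnegative random variable $X$ is infinitely divisible if for every integer $n\ge1$ it has the same distribution as a sum of $n$ independent identically distributed random variables. A function $g:(0,\infty)\to[0,\infty)$ is a Bernstein function if its derivative is completely monotone, i.e. $g'$ has derivatives of all orders and $(-1)^k (g')^{(k)}\ge 0$ for all $k\ge 0$. A nonnegative random variable $X$ is a generalized gamma convolution (GGC) if there are $a\ge 0$ and a nonnegative measure $\mu$ on $(0,\infty)$ such that $\mathbb{E}[e^{-sX}]=\exp\left(-as-\int_0^\infty\log(1+s/u)\,\mu(du)\right)$ for all $s\ge0$.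
   Formalization: The claim that X is not a generalized gamma convolution is stated only for K > 0: for K = 0 (Rayleigh fading) X is exponential with mean 1, which is a GGC (a = 0, unit point mass at 1). All other claims are stated for every K ≥ 0. *)

theory Defs
  imports "HOL-Probability.Probability"
begin

definition laplace_transform :: "'a measure \<Rightarrow> ('a \<Rightarrow> real) \<Rightarrow> real \<Rightarrow> real" where
  "laplace_transform M X s = (\<integral>\<omega>. exp (- s * X \<omega>) \<partial>M)"

definition laplace_exponent :: "'a measure \<Rightarrow> ('a \<Rightarrow> real) \<Rightarrow> real \<Rightarrow> real" where
  "laplace_exponent M X s = - ln (laplace_transform M X s)"

(* Functions on (0,\<infinity>) are represented by total functions on the reals. As (0,\<infinity>) is open,
   the predicates below depend only on the values at positive arguments. *)

definition completely_monotone :: "(real \<Rightarrow> real) \<Rightarrow> bool" where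
  "completely_monotone f \<longleftrightarrow>
     (\<forall>k. \<forall>x>0. (deriv ^^ k) f differentiable (at x) \<and> (- 1) ^ k * (deriv ^^ k) f x \<ge> 0)"

definition bernstein_function :: "(real \<Rightarrow> real) \<Rightarrow> bool" where
  "bernstein_function g \<longleftrightarrow>
     (\<forall>x>0. g x \<ge> 0) \<and> (\<forall>x>0. g differentiable (at x)) \<and> completely_monotone (deriv g)"

(* The summands may live on a probability space other than M. HOL cannot quantify over the type
   of its points, but sequences of reals lose no generality: given summands on any space, take
   their joint law with the coordinate projections. *)

definition infinitely_divisible :: "'a measure \<Rightarrow> ('a \<Rightarrow> real) \<Rightarrow> bool" where
  "infinitely_divisible M X \<longleftrightarrow>
     (\<forall>n::nat. n \<ge> 1 \<longrightarrow>
       (\<exists>(N :: (nat \<Rightarrow> real) measure) (Y :: nat \<Rightarrow> (nat \<Rightarrow> real) \<Rightarrow> real).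
          prob_space N \<and>
          prob_space.indep_vars N (\<lambda>_. borel) Y {..<n} \<and>
          (\<forall>i<n. \<forall>j<n. distr N borel (Y i) = distr N borel (Y j)) \<and>
          distr M borel X = distr N borel (\<lambda>\<omega>. \<Sum>i<n. Y i \<omega>)))"

(* Integrability is demanded because the Bochner integral of a non-integrable function is 0,
   whereas here the integrand is nonnegative and a divergent integral would make the right-hand
   side exp (-\<infinity>) = 0, which is never a value of a Laplace transform. *)

definition generalized_gamma_convolution :: "'a measure \<Rightarrow> ('a \<Rightarrow> real) \<Rightarrow> bool" where
  "generalized_gamma_convolution M X \<longleftrightarrow>
     (\<exists>(a::real) (\<mu> :: real measure).
        a \<ge> 0 \<and>
        sets \<mu> = sets (restrict_space borel {0<..}) \<and>
        (\<forall>s\<ge>0. integrable \<mu> (\<lambda>u. ln (1 + s / u)) \<and>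
           laplace_transform M X s = exp (- a * s - (\<integral>u. ln (1 + s / u) \<partial>\<mu>))))"

end

(* The n-th convolution root of the Rician power law is a Gamma law whose shape is 1/n plus a
   Poisson variable of mean K/n; that the n-fold convolution is the law of X follows from the
   uniqueness of Laplace transforms, which reduces to that of characteristic functions because
   exp (- X) is bounded, so that its moments determine its characteristic function.

   To refute the GGC property, put c = 1 + K and use the identity
   (t + 18c)(t + 3c)^2 - (t + 9c)^2 (t + 2c) = 4ct^2 >= 0 with t = u - c(1 - d). It shows that
   F(r 18) + 2 F(r 3) - 2 F(r 9) - F(r 2) >= 0 for F(s) = ln (1 + s/u) and r x = c(x - 1 + d), hence
   for the Laplace exponent F of every GGC. For the Rician exponent the logarithmic part of this
   combination is O(d^2), while the part K s/(c + s) contributes a negative term of order d. *)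

theory Submission
  imports Defs "HOL-Real_Asymp.Real_Asymp"
begin

section \<open>Moments and the uniqueness of Laplace transforms\<close>

text \<open>The remainder of the Taylor expansion of a characteristic function after degree n is at
  most \<open>2 * \<bar>t\<bar> ^ n / fact n\<close> times the n-th absolute moment. Concentration
  on [-1, 1] bounds that moment by 1, so the remainder tends to 0.\<close>

lemma (in real_distribution) char_sums_moments:
  assumes "AE x in M. \<bar>x\<bar> \<le> 1"
  shows "(\<lambda>k. (\<i> * t) ^ k / fact k * expectation (\<lambda>x. x ^ k)) sums char M t"
proof -
  have bd: "AE x in M. norm (x ^ k) \<le> 1" for k :: nat
    using assms by eventually_elim (simp add: norm_power power_abs power_le_one)
  have int: "integrable M (\<lambda>x. x ^ k)" for k :: nat
    by (rule integrable_const_bound[OF bd]) simp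
  have intabs: "integrable M (\<lambda>x. \<bar>x\<bar> ^ k)" for k :: nat
    using integrable_abs[OF int[of k]] by (simp add: power_abs)
  have abs_le: "expectation (\<lambda>x. \<bar>x\<bar> ^ k) \<le> 1" for k :: nat
  proof -
    have "expectation (\<lambda>x. \<bar>x\<bar> ^ k) \<le> expectation (\<lambda>x. 1)"
      by (rule integral_mono_AE[OF intabs]) (use bd[of k] in \<open>auto simp: power_abs\<close>)
    then show ?thesis using prob_space by simp
  qed
  have "(\<lambda>n. (\<Sum>k\<le>n. (\<i> * t) ^ k / fact k * expectation (\<lambda>x. x ^ k)) - char M t) \<longlonglongrightarrow> 0"
  proof (rule Lim_null_comparison)
    show "\<forall>\<^sub>F n in sequentially. norm ((\<Sum>k\<le>n. (\<i> * t) ^ k / fact k * expectation (\<lambda>x. x ^ k)) - char M t)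
            \<le> 2 * \<bar>t\<bar> ^ n / fact n"
    proof (rule always_eventually, rule allI)
      fix n
      have "norm ((\<Sum>k\<le>n. (\<i> * t) ^ k / fact k * expectation (\<lambda>x. x ^ k)) - char M t)
          \<le> (2 * \<bar>t\<bar> ^ n / fact n) * expectation (\<lambda>x. \<bar>x\<bar> ^ n)"
        using char_approx1[of n t, OF int] by (simp add: norm_minus_commute)
      also have "\<dots> \<le> (2 * \<bar>t\<bar> ^ n / fact n) * 1"
        by (intro mult_left_mono abs_le) simp
      finally show "norm ((\<Sum>k\<le>n. (\<i> * t) ^ k / fact k * expectation (\<lambda>x. x ^ k)) - char M t)
            \<le> 2 * \<bar>t\<bar> ^ n / fact n" by simp
    qed
    have "(\<lambda>n. 2 * (inverse (fact n) * \<bar>t\<bar> ^ n)) \<longlonglongrightarrow> 2 * 0"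
      by (intro tendsto_mult_left summable_LIMSEQ_zero[OF summable_exp])
    then show "(\<lambda>n. 2 * \<bar>t\<bar> ^ n / fact n) \<longlonglongrightarrow> 0"
      by (simp add: field_simps)
  qed
  then show ?thesis
    unfolding sums_def_le by (simp add: LIM_zero_iff)
qed

text \<open>The k-th moment of \<open>exp (- X)\<close> is the Laplace transform of \<open>X\<close>
  at k, so agreement at natural arguments suffices. Nonnegativity of \<open>X\<close> keeps
  \<open>exp (- X)\<close> in (0, 1] almost everywhere, where the moments give the characteristic
  function.\<close>

lemma distr_eq_if_laplace_transform_eq:
  assumes "prob_space M" "prob_space N"
    and X [measurable]: "X \<in> borel_measurable M" and Y [measurable]: "Y \<in> borel_measurable N"
    and X0: "AE \<omega> in M. 0 \<le> X \<omega>" and Y0: "AE \<omega> in N. 0 \<le> Y \<omega>"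
    and eq: "\<And>k::nat. laplace_transform M X k = laplace_transform N Y k"
  shows "distr M borel X = distr N borel Y"
proof -
  define A where "A = distr M borel (\<lambda>\<omega>. exp (- X \<omega>))"
  define B where "B = distr N borel (\<lambda>\<omega>. exp (- Y \<omega>))"
  interpret M: prob_space M by fact
  interpret N: prob_space N by fact
  interpret A: real_distribution A unfolding A_def by (rule M.real_distribution_distr) simp
  interpret B: real_distribution B unfolding B_def by (rule N.real_distribution_distr) simp
  have momA: "A.expectation (\<lambda>x. x ^ k) = laplace_transform M X k" for k
    unfolding A_def laplace_transform_def
    by (subst integral_distr) (simp_all flip: exp_of_nat_mult)
  have momB: "B.expectation (\<lambda>x. x ^ k) = laplace_transform N Y k" for k
    unfolding B_def laplace_transform_def
    by (subst integral_distr) (simp_all flip: exp_of_nat_mult)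
  have A1: "AE x in A. \<bar>x\<bar> \<le> 1"
    unfolding A_def by (subst AE_distr_iff) (use X0 in auto)
  have B1: "AE x in B. \<bar>x\<bar> \<le> 1"
    unfolding B_def by (subst AE_distr_iff) (use Y0 in auto)
  have "char A t = char B t" for t
    using A.char_sums_moments[OF A1, of t] B.char_sums_moments[OF B1, of t]
    unfolding momA momB eq by (rule sums_unique2)
  then have "A = B"
    by (intro Levy_uniqueness A.real_distribution_axioms B.real_distribution_axioms) auto
  \<comment> \<open>The map \<open>- ln x\<close> inverts \<open>exp (- x)\<close>, so pushing
    forward along it recovers the laws of \<open>X\<close> and \<open>Y\<close>.\<close>
  then have "distr A borel (\<lambda>x. - ln x) = distr B borel (\<lambda>x. - ln x)" by simp
  then show ?thesis
    unfolding A_def B_def by (simp add: distr_distr comp_def)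
qed

section \<open>Gamma integrals and Gamma-Poisson mixtures\<close>

text \<open>Substitute \<open>b * x\<close> in Euler's integral; the Jacobian \<open>b\<close> and
  the factor \<open>b powr (a - 1)\<close> combine to \<open>b powr a\<close>. With values in
  \<open>ennreal\<close> the formula serves to integrate a series of nonnegative terms without
  integrability conditions.\<close>

lemma nn_integral_Gamma_scaled:
  fixes a b :: real
  assumes a: "a > 0" and b: "b > 0"
  shows "(\<integral>\<^sup>+x. ennreal (indicator {0..} x * x powr (a - 1) * exp (- b * x)) \<partial>lborel)
           = ennreal (Gamma a / b powr a)"
proof -
  let ?I = "\<integral>\<^sup>+x. ennreal (indicator {0..} x * x powr (a - 1) * exp (- b * x)) \<partial>lborel"
  have "ennreal (Gamma a) = ennreal \<bar>b\<bar> *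
      (\<integral>\<^sup>+x. ennreal (indicator {0..} (0 + b * x) * (0 + b * x) powr (a - 1) / exp (0 + b * x)) \<partial>lborel)"
    unfolding Gamma_conv_nn_integral_real[OF a] using b
    by (intro nn_integral_real_affine) auto
  also have "\<dots> = ennreal b * (\<integral>\<^sup>+x. ennreal (b powr (a - 1)) *
        ennreal (indicator {0..} x * x powr (a - 1) * exp (- b * x)) \<partial>lborel)"
  proof -
    have "ennreal (indicator {0..} (0 + b * x) * (0 + b * x) powr (a - 1) / exp (0 + b * x))
        = ennreal (b powr (a - 1)) * ennreal (indicator {0..} x * x powr (a - 1) * exp (- b * x))" for x
      using b by (auto simp: indicator_def powr_mult exp_minus divide_inverse zero_le_mult_iff mult_ac
          simp flip: ennreal_mult)
    then show ?thesis using b by simp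
  qed
  also have "\<dots> = ennreal b * (ennreal (b powr (a - 1)) * ?I)"
    by (subst nn_integral_cmult) auto
  also have "\<dots> = ennreal (b powr a) * ?I"
  proof -
    have "b powr a = b * b powr (a - 1)" using b by (simp add: powr_mult_base)
    then show ?thesis using b by (simp add: ennreal_mult mult.assoc)
  qed
  finally have eq: "ennreal (Gamma a) = ennreal (b powr a) * ?I" .
  have "?I = ennreal (inverse (b powr a)) * (ennreal (b powr a) * ?I)"
    using b by (simp flip: mult.assoc ennreal_mult)
  also have "\<dots> = ennreal (Gamma a / b powr a)"
    unfolding eq[symmetric] using a b by (simp add: divide_inverse mult.commute Gamma_real_pos flip: ennreal_mult)
  finally show ?thesis .
qed

text \<open>The measure is the law of a Gamma variable whose shape is \<open>p\<close> plus a Poisson variable of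
  mean \<open>l\<close>.\<close>

lemma ex_gamma_poisson_mixture:
  fixes p c l :: real
  assumes p: "p > 0" and c: "c > 0" and l: "l \<ge> 0"
  shows "\<exists>D. prob_space D \<and> sets D = sets borel \<and> (AE x in D. 0 \<le> x) \<and>
           (\<forall>s\<ge>0. laplace_transform D (\<lambda>x. x) s = (c / (c + s)) powr p * exp (- (l * s / (c + s))))"
proof -
  \<comment> \<open>\<open>g k\<close> is the Poisson weight of k with mean \<open>l\<close> times
    the Gamma density of shape \<open>p + k\<close> and rate \<open>c\<close>.\<close>
  define g where "g k x = exp (- l) * l ^ k / fact k * c powr (p + real k) / Gamma (p + real k) *
      (indicator {0..} x * x powr (p + real k - 1) * exp (- c * x))" for k x
  define f where "f x = (\<Sum>k. ennreal (g k x))" for x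
  define D where "D = density lborel f"
  have Gpos: "Gamma (p + real k) > 0" for k
    using p by (intro Gamma_real_pos) auto
  have g_nn: "0 \<le> g k x" for k x
    unfolding g_def using l Gpos[of k] by (intro mult_nonneg_nonneg divide_nonneg_nonneg) auto
  have g_meas [measurable]: "g k \<in> borel_measurable borel" for k
    unfolding g_def by measurable
  have f_meas [measurable]: "f \<in> borel_measurable borel"
    unfolding f_def by measurable
  \<comment> \<open>The Gamma law of shape \<open>p + k\<close> and rate \<open>c\<close> has
    transform \<open>(c / (c + s)) powr (p + k)\<close>. Its k-dependent part joins
    \<open>l ^ k\<close>, which turns the sum over k into an exponential series.\<close>
  have g_int: "(\<integral>\<^sup>+x. ennreal (g k x) * ennreal (exp (- s * x)) \<partial>lborel)
      = ennreal (exp (- l) * (c / (c + s)) powr p * ((l * (c / (c + s))) ^ k / fact k))" if "s \<ge> 0" for s k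
  proof -
    define C where "C = exp (- l) * l ^ k / fact k * c powr (p + real k) / Gamma (p + real k)"
    have C: "C \<ge> 0" unfolding C_def using l Gpos[of k] by simp
    have cs: "c + s > 0" and pk: "p + real k > 0" using c p that by auto
    have "(\<integral>\<^sup>+x. ennreal (g k x) * ennreal (exp (- s * x)) \<partial>lborel)
        = (\<integral>\<^sup>+x. ennreal C * ennreal (indicator {0..} x * x powr (p + real k - 1) * exp (- (c + s) * x)) \<partial>lborel)"
    proof (rule nn_integral_cong)
      fix x
      have "g k x * exp (- s * x) = C * (indicator {0..} x * x powr (p + real k - 1) * exp (- (c + s) * x))"
        unfolding g_def C_def by (simp add: algebra_simps exp_add exp_diff exp_minus divide_inverse)
      then show "ennreal (g k x) * ennreal (exp (- s * x)) =
          ennreal C * ennreal (indicator {0..} x * x powr (p + real k - 1) * exp (- (c + s) * x))"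
        using C g_nn by (simp flip: ennreal_mult)
    qed
    also have "\<dots> = ennreal C * ennreal (Gamma (p + real k) / (c + s) powr (p + real k))"
      by (subst nn_integral_cmult) (auto simp: nn_integral_Gamma_scaled[OF pk cs, simplified])
    also have "\<dots> = ennreal (C * (Gamma (p + real k) / (c + s) powr (p + real k)))"
      using C Gpos[of k] by (simp flip: ennreal_mult)
    also have "C * (Gamma (p + real k) / (c + s) powr (p + real k))
        = exp (- l) * l ^ k / fact k * (c / (c + s)) powr (p + real k)"
      unfolding C_def using c cs Gpos[of k] by (simp add: powr_divide)
    also have "\<dots> = exp (- l) * (c / (c + s)) powr p * ((l * (c / (c + s))) ^ k / fact k)"
      using c cs by (simp add: powr_add powr_realpow power_mult_distrib power_divide mult_ac)
    finally show ?thesis .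
  qed
  have LT: "(\<integral>\<^sup>+x. ennreal (exp (- s * x)) \<partial>D) = ennreal ((c / (c + s)) powr p * exp (- (l * s / (c + s))))"
    if s: "s \<ge> 0" for s
  proof -
    have cs: "c + s > 0" using c s by simp
    have "(\<integral>\<^sup>+x. ennreal (exp (- s * x)) \<partial>D) = (\<integral>\<^sup>+x. (\<Sum>k. ennreal (g k x) * ennreal (exp (- s * x))) \<partial>lborel)"
      unfolding D_def by (simp add: nn_integral_density f_def)
    also have "\<dots> = (\<Sum>k. (\<integral>\<^sup>+x. ennreal (g k x) * ennreal (exp (- s * x)) \<partial>lborel))"
      by (rule nn_integral_suminf) simp
    also have "\<dots> = (\<Sum>k. ennreal (exp (- l) * (c / (c + s)) powr p * ((l * (c / (c + s))) ^ k / fact k)))"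
      by (simp only: g_int[OF s])
    also have "\<dots> = ennreal (exp (- l) * (c / (c + s)) powr p * exp (l * (c / (c + s))))"
    proof (rule suminf_ennreal_eq)
      show "0 \<le> exp (- l) * (c / (c + s)) powr p * ((l * (c / (c + s))) ^ k / fact k)" for k
        using l c cs by simp
      show "(\<lambda>k. exp (- l) * (c / (c + s)) powr p * ((l * (c / (c + s))) ^ k / fact k)) sums
          (exp (- l) * (c / (c + s)) powr p * exp (l * (c / (c + s))))"
        using sums_mult[OF exp_converges[of "l * (c / (c + s))"], of "exp (- l) * (c / (c + s)) powr p"]
        by (simp add: divide_inverse mult.commute)
    qed
    also have "exp (- l) * (c / (c + s)) powr p * exp (l * (c / (c + s)))
        = (c / (c + s)) powr p * exp (- l + l * (c / (c + s)))"
      by (simp only: exp_add mult_ac)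
    also have "- l + l * (c / (c + s)) = - (l * s / (c + s))"
      using cs by (simp add: field_simps)
    finally show ?thesis .
  qed
  have setsD: "sets D = sets borel" unfolding D_def by simp
  \<comment> \<open>The transform at 0 is the total mass.\<close>
  have "emeasure D (space D) = 1"
    using LT[of 0] c by simp
  then have "prob_space D" by (rule prob_spaceI)
  moreover have "AE x in D. 0 \<le> x"
  proof -
    have "f x = 0" if "x < 0" for x
      using that by (simp add: f_def g_def)
    then have "0 < f x \<Longrightarrow> 0 \<le> x" for x
      by (metis less_irrefl not_le)
    then show ?thesis
      unfolding D_def by (subst AE_density) auto
  qed
  moreover have "laplace_transform D (\<lambda>x. x) s = (c / (c + s)) powr p * exp (- (l * s / (c + s)))"
    if s: "s \<ge> 0" for s
    unfolding laplace_transform_def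
    using LT[OF s] c s
    by (subst integral_eq_nn_integral) (auto simp: D_def)
  ultimately show ?thesis using setsD by blast
qed

section \<open>Failure of the GGC property\<close>

text \<open>The term \<open>K * s / (c + s)\<close> is \<open>- K * c\<close> times the derivative
  of \<open>ln (1 + s / u)\<close> in \<open>u\<close> at \<open>u = c\<close>: the exponent
  corresponds to a point mass plus a dipole at \<open>c\<close>. A nonnegative function of
  \<open>u\<close> with a double zero just to the left of \<open>c\<close> is small at
  \<open>c\<close> but increasing there, so the dipole makes its pairing negative.\<close>

lemma not_generalized_gamma_convolution_if:
  fixes c K :: real
  assumes c: "c > 0" and K: "K > 0"
    and lap: "\<And>s. s \<ge> 0 \<Longrightarrow> laplace_transform M X s = exp (- (ln ((c + s) / c) + K * s / (c + s)))"
  shows "\<not> generalized_gamma_convolution M X"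
proof
  assume "generalized_gamma_convolution M X"
  then obtain a :: real and \<mu> :: "real measure" where a: "a \<ge> 0"
    and sets: "sets \<mu> = sets (restrict_space borel {0<..})"
    and int: "\<And>s. s \<ge> 0 \<Longrightarrow> integrable \<mu> (\<lambda>u. ln (1 + s / u))"
    and lap': "\<And>s. s \<ge> 0 \<Longrightarrow> laplace_transform M X s = exp (- a * s - (\<integral>u. ln (1 + s / u) \<partial>\<mu>))"
    unfolding generalized_gamma_convolution_def by blast
  define I where "I s = (\<integral>u. ln (1 + s / u) \<partial>\<mu>)" for s
  have pos: "u > 0" if "u \<in> space \<mu>" for u
    using that sets_eq_imp_space_eq[OF sets] by (simp add: space_restrict_space)
  have expo: "a * s + I s = ln ((c + s) / c) + K * s / (c + s)" if "s \<ge> 0" for s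
    using lap[OF that] lap'[OF that] by (simp add: I_def)
  \<comment> \<open>\<open>d \<le> K / 2\<close> lets the first-order term dominate the quadratic
    one at the end; \<open>d \<le> 1\<close> bounds the denominators there.\<close>
  define d where "d = min 1 (K / 2)"
  have d: "0 < d" "d \<le> 1" "d \<le> K / 2" using K by (auto simp: d_def)
  define r where "r x = c * (x - 1 + d)" for x
  have r_nn: "r 18 \<ge> 0" "r 3 \<ge> 0" "r 9 \<ge> 0" "r 2 \<ge> 0"
    using c d by (auto simp: r_def)
  have "0 \<le> (\<integral>u. ln (1 + r 18 / u) + 2 * ln (1 + r 3 / u) - 2 * ln (1 + r 9 / u) - ln (1 + r 2 / u) \<partial>\<mu>)"
  proof (rule integral_nonneg_AE, rule AE_I2)
    fix u assume "u \<in> space \<mu>"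
    then have u: "u > 0" by (rule pos)
    \<comment> \<open>The double zero is at \<open>v = 0\<close>, that is, at
      \<open>u = c * (1 - d)\<close>.\<close>
    define v where "v = u - c * (1 - d)"
    have eq: "1 + r x / u = (v + x * c) / u" for x
      using u by (simp add: r_def v_def field_simps)
    have vpos: "v + 18 * c > 0" "v + 3 * c > 0" "v + 9 * c > 0" "v + 2 * c > 0"
      using u r_nn c by (auto simp: v_def r_def algebra_simps)
    \<comment> \<open>The triples 18, 3, 3 and 9, 9, 2 share the product 162 and the sum 117 of
      pairwise products, while their sums are 24 and 20. Hence the two cubics differ only in the
      quadratic term.\<close>
    have "(v + 9 * c)\<^sup>2 * (v + 2 * c) \<le> (v + 18 * c) * (v + 3 * c)\<^sup>2"
    proof -
      have "(v + 18 * c) * (v + 3 * c)\<^sup>2 - (v + 9 * c)\<^sup>2 * (v + 2 * c) = 4 * c * v\<^sup>2"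
        by (simp add: power2_eq_square algebra_simps)
      moreover have "4 * c * v\<^sup>2 \<ge> 0" using c by simp
      ultimately show ?thesis by linarith
    qed
    then have "ln ((v + 9 * c)\<^sup>2 * (v + 2 * c)) \<le> ln ((v + 18 * c) * (v + 3 * c)\<^sup>2)"
      using vpos by (subst ln_le_cancel_iff) auto
    then show "0 \<le> ln (1 + r 18 / u) + 2 * ln (1 + r 3 / u) - 2 * ln (1 + r 9 / u) - ln (1 + r 2 / u)"
      unfolding eq using u vpos by (simp add: ln_div ln_mult ln_realpow)
  qed
  also have "\<dots> = I (r 18) + 2 * I (r 3) - 2 * I (r 9) - I (r 2)"
    unfolding I_def using r_nn by (simp add: int)
  \<comment> \<open>The weights 1, 2, -2, -1 applied to \<open>r\<close> give \<open>4 * c\<close>,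
    so adding the drift can only increase the combination.\<close>
  also have "\<dots> \<le> (a * r 18 + I (r 18)) + 2 * (a * r 3 + I (r 3)) - 2 * (a * r 9 + I (r 9)) - (a * r 2 + I (r 2))"
  proof -
    have "a * r 18 + 2 * (a * r 3) - 2 * (a * r 9) - a * r 2 = 4 * (a * c)"
      by (simp add: r_def algebra_simps)
    moreover have "a * c \<ge> 0" using a c by simp
    ultimately show ?thesis unfolding distrib_left by linarith
  qed
  \<comment> \<open>Since \<open>c + r x = c * (x + d)\<close>, the scale \<open>c\<close> drops out
    and the exponent at \<open>r x\<close> is \<open>ln (x + d) + K - K / (x + d)\<close>. The
    weights sum to 0, so the constant \<open>K\<close> cancels.\<close>
  also have "\<dots> = (ln (18 + d) + 2 * ln (3 + d) - 2 * ln (9 + d) - ln (2 + d))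
      - K * (1 / (18 + d) + 2 / (3 + d) - 2 / (9 + d) - 1 / (2 + d))"
  proof -
    have "(c + r x) / c = x + d" for x
      using c by (simp add: r_def field_simps)
    moreover have "r x / (c + r x) = 1 - 1 / (x + d)" if "x \<ge> 1" for x
    proof -
      have "r x = c * (x + d) - c" by (simp add: r_def algebra_simps)
      moreover have "x + d > 0" using that d by simp
      ultimately show ?thesis using c by (simp add: diff_divide_distrib)
    qed
    ultimately have e: "a * r x + I (r x) = ln (x + d) + K - K * (1 / (x + d))" if "x \<ge> 1" "r x \<ge> 0" for x
      using that expo[of "r x"] by (metis (no_types) diff_add_eq add_diff_eq mult.right_neutral right_diff_distrib times_divide_eq_right)
    show ?thesis
      unfolding e[OF _ r_nn(1), simplified] e[OF _ r_nn(2), simplified]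
        e[OF _ r_nn(3), simplified] e[OF _ r_nn(4), simplified]
      by (simp add: algebra_simps)
  qed
  also have "\<dots> < 0"
  proof -
    have q: "(9 + d)\<^sup>2 * (2 + d) \<ge> 162"
    proof -
      have "(9 + d)\<^sup>2 \<ge> 9\<^sup>2" using d by (intro power_mono) auto
      then have "9\<^sup>2 * 2 \<le> (9 + d)\<^sup>2 * (2 + d)" using d by (intro mult_mono) auto
      then show ?thesis by simp
    qed
    have "ln (18 + d) + 2 * ln (3 + d) - 2 * ln (9 + d) - ln (2 + d)
        = ln ((18 + d) * (3 + d)\<^sup>2 / ((9 + d)\<^sup>2 * (2 + d)))"
      using d by (simp add: ln_div ln_mult ln_realpow)
    also have "(18 + d) * (3 + d)\<^sup>2 / ((9 + d)\<^sup>2 * (2 + d)) = 1 + 4 * d\<^sup>2 / ((9 + d)\<^sup>2 * (2 + d))"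
    proof -
      have "(18 + d) * (3 + d)\<^sup>2 = (9 + d)\<^sup>2 * (2 + d) + 4 * d\<^sup>2"
        by (simp add: power2_eq_square algebra_simps)
      then show ?thesis using d by (simp add: add_divide_distrib)
    qed
    also have "ln \<dots> \<le> 4 * d\<^sup>2 / ((9 + d)\<^sup>2 * (2 + d))"
      using d by (intro ln_add_one_self_le_self) auto
    also have "\<dots> \<le> 4 * d\<^sup>2 / 162"
      using q by (intro divide_left_mono) auto
    also have "\<dots> = 4 * d * d / 162" by (simp add: power2_eq_square)
    also have "\<dots> \<le> 4 * d * (K / 2) / 162"
      using d by (intro divide_right_mono mult_left_mono) auto
    also have "\<dots> = K * (d / 81)" by simp
    \<comment> \<open>The rational combination vanishes at \<open>d = 0\<close> and has the factor
      \<open>4 * d * (12 - d)\<close>. For \<open>d \<le> 1\<close> it is at least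
      \<open>44 * d / 2280\<close>, which exceeds \<open>d / 81\<close>.\<close>
    also have "\<dots> < K * (1 / (18 + d) + 2 / (3 + d) - 2 / (9 + d) - 1 / (2 + d))"
    proof (rule mult_strict_left_mono[OF _ K])
      have "1 / (18 + d) + 2 / (3 + d) - 2 / (9 + d) - 1 / (2 + d)
          = 4 * d * (12 - d) / ((18 + d) * (3 + d) * ((9 + d) * (2 + d)))"
        using d by (simp add: divide_simps) (simp add: algebra_simps)
      moreover have "4 * d * 11 / (19 * 4 * (10 * 3)) \<le> 4 * d * (12 - d) / ((18 + d) * (3 + d) * ((9 + d) * (2 + d)))"
        using d by (intro frac_le mult_mono mult_left_mono mult_pos_pos) auto
      moreover have "d / 81 < 4 * d * 11 / (19 * 4 * (10 * 3))" using d by simp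
      ultimately show "d / 81 < 1 / (18 + d) + 2 / (3 + d) - 2 / (9 + d) - 1 / (2 + d)" by linarith
    qed
    finally show ?thesis by linarith
  qed
  finally show False by simp
qed

section \<open>Integral representation and Bernstein property of the exponent\<close>

text \<open>Write \<open>1 - exp (- s * x)\<close> as an integral over y in [0, x] and exchange the
  integrals by Tonelli. The integral over s is then \<open>K * c / (c + y)^2 + 1 / (c + y)\<close>,
  with antiderivative \<open>ln (c + y) - K * c / (c + y)\<close>. Working in \<open>ennreal\<close>
  yields integrability along with the value.\<close>

lemma rician_exponent_integral:
  fixes c K x :: real
  assumes c: "c > 0" and K: "K \<ge> 0" and x: "x \<ge> 0"
  shows "has_bochner_integral lborel
           (\<lambda>s. indicator {0<..} s * ((1 - exp (- s * x)) * (exp (- c * s) * (K * c + 1 / s))))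
           (ln ((c + x) / c) + K * x / (c + x))"
proof (rule has_bochner_integral_nn_integral)
  let ?f = "\<lambda>s. indicator {0<..} s * ((1 - exp (- s * x)) * (exp (- c * s) * (K * c + 1 / s)))"
  \<comment> \<open>Differentiating the integrand in its parameter cancels the singular factor
    \<open>1 / s\<close>.\<close>
  define h where "h y s = (K * c * s + 1) * exp (- (c + y) * s)" for y s
  have h_nn: "h y s \<ge> 0" if "s \<ge> 0" for y s
    using that K c by (simp add: h_def)
  have h_meas [measurable]: "(\<lambda>z. h (fst z) (snd z)) \<in> borel_measurable (borel \<Otimes>\<^sub>M borel)"
    unfolding h_def by measurable
  show "?f \<in> borel_measurable lborel" by measurable
  show "AE s in lborel. 0 \<le> ?f s"
    using x c K by (intro AE_I2) (auto simp: indicator_def intro!: mult_nonneg_nonneg add_nonneg_nonneg)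
  have cp: "c + y > 0" if "y \<ge> 0" for y using c that by simp
  show "0 \<le> ln ((c + x) / c) + K * x / (c + x)"
    using c x K by (intro add_nonneg_nonneg ln_ge_zero divide_nonneg_nonneg) auto
  have inner: "ennreal (?f s) = (\<integral>\<^sup>+y. ennreal (h y s) * indicator {0..x} y * indicator {0<..} s \<partial>lborel)" for s
  proof (cases "s > 0")
    case True
    define F where "F y = - (K * c + 1 / s) * exp (- (c + y) * s)" for y
    have "(\<integral>\<^sup>+y. ennreal (h y s) * indicator {0..x} y \<partial>lborel) = ennreal (F x - F 0)"
    proof (rule nn_integral_FTC_Icc)
      show "(\<lambda>y. h y s) \<in> borel_measurable borel" unfolding h_def by measurable
      show "DERIV F y :> h y s" for y
      proof -
        have "DERIV F y :> - (K * c + 1 / s) * (exp (- (c + y) * s) * - s)"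
          unfolding F_def by (auto intro!: derivative_eq_intros)
        moreover have "- (K * c + 1 / s) * (exp (- (c + y) * s) * - s) = h y s"
        proof -
          have "(K * c + 1 / s) * s = K * c * s + 1" using True by (simp add: distrib_right)
          moreover have "- A * (E * - s) = A * s * E" for A E :: real by simp
          ultimately show ?thesis unfolding h_def by (simp only:)
        qed
        ultimately show ?thesis by (simp only:)
      qed
      show "0 \<le> h y s" for y using True by (intro h_nn) simp
    qed (rule x)
    also have "F x - F 0 = (1 - exp (- s * x)) * (exp (- c * s) * (K * c + 1 / s))"
      unfolding F_def by (simp add: algebra_simps exp_add exp_diff exp_minus divide_inverse)
    finally show ?thesis using True by simp
  qed simp
  have outer: "(\<integral>\<^sup>+s. ennreal (h y s) * indicator {0<..} s \<partial>lborel) = ennreal (K * c / (c + y)\<^sup>2 + 1 / (c + y))"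
    if y: "y \<ge> 0" for y
  proof -
    define b where "b = c + y"
    have b: "b > 0" unfolding b_def by (rule cp[OF y])
    define F where "F s = - (K * c * s / b + K * c / b\<^sup>2 + 1 / b) * exp (- b * s)" for s
    \<comment> \<open>The null point 0 is added because the fundamental theorem is applied on the
      closed half-line.\<close>
    have "(\<integral>\<^sup>+s. ennreal (h y s) * indicator {0<..} s \<partial>lborel) = (\<integral>\<^sup>+s. ennreal (h y s) * indicator {0..} s \<partial>lborel)"
      by (rule nn_integral_cong_AE, rule AE_mp[OF AE_lborel_singleton[of 0]]) (auto simp: indicator_def)
    also have "\<dots> = ennreal (0 - F 0)"
    proof (rule nn_integral_FTC_atLeast)
      show "h y \<in> borel_measurable borel" unfolding h_def by measurable
      show "DERIV F s :> h y s" for s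
        unfolding F_def h_def b_def[symmetric] using b
        by (auto intro!: derivative_eq_intros simp: field_simps power2_eq_square)
      show "(F \<longlongrightarrow> 0) at_top"
        unfolding F_def using b by real_asymp
    qed (rule h_nn)
    also have "0 - F 0 = K * c / (c + y)\<^sup>2 + 1 / (c + y)"
      unfolding F_def b_def by simp
    finally show ?thesis .
  qed
  have "(\<integral>\<^sup>+s. ennreal (?f s) \<partial>lborel)
      = (\<integral>\<^sup>+s. \<integral>\<^sup>+y. ennreal (h y s) * indicator {0..x} y * indicator {0<..} s \<partial>lborel \<partial>lborel)"
    by (simp only: inner)
  also have "\<dots> = (\<integral>\<^sup>+y. \<integral>\<^sup>+s. ennreal (h y s) * indicator {0..x} y * indicator {0<..} s \<partial>lborel \<partial>lborel)"
    by (rule lborel_pair.Fubini') (simp add: case_prod_beta)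
  also have "\<dots> = (\<integral>\<^sup>+y. ennreal (K * c / (c + y)\<^sup>2 + 1 / (c + y)) * indicator {0..x} y \<partial>lborel)"
  proof (rule nn_integral_cong)
    fix y
    show "(\<integral>\<^sup>+s. ennreal (h y s) * indicator {0..x} y * indicator {0<..} s \<partial>lborel)
        = ennreal (K * c / (c + y)\<^sup>2 + 1 / (c + y)) * indicator {0..x} y"
      by (cases "y \<in> {0..x}") (simp_all add: outer)
  qed
  also have "\<dots> = ennreal ((ln (c + x) - K * c / (c + x)) - (ln (c + 0) - K * c / (c + 0)))"
  proof (rule nn_integral_FTC_Icc[where F = "\<lambda>y. ln (c + y) - K * c / (c + y)"])
    fix y assume "y \<in> {0..x}"
    then have "c + y > 0" by (intro cp) simp
    then show "DERIV (\<lambda>y. ln (c + y) - K * c / (c + y)) y :> K * c / (c + y)\<^sup>2 + 1 / (c + y)"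
      by (auto intro!: derivative_eq_intros simp: power2_eq_square)
    show "0 \<le> K * c / (c + y)\<^sup>2 + 1 / (c + y)" using \<open>c + y > 0\<close> K c by simp
  qed (use x in auto)
  also have "(ln (c + x) - K * c / (c + x)) - (ln (c + 0) - K * c / (c + 0)) = ln ((c + x) / c) + K * x / (c + x)"
    using c cp[OF x] by (simp add: ln_div field_simps)
  finally show "(\<integral>\<^sup>+s. ennreal (?f s) \<partial>lborel) = ennreal (ln ((c + x) / c) + K * x / (c + x))" .
qed

text \<open>On the positive axis the derivative is \<open>1 / (c + x) + K * c / (c + x)^2\<close>, a
  nonnegative combination of inverse powers, so its derivatives alternate in sign.\<close>

lemma bernstein_function_rician_exponent:
  fixes c K :: real
  assumes c: "c > 0" and K: "K \<ge> 0"
    and g: "\<And>x. x > 0 \<Longrightarrow> g x = ln ((c + x) / c) + K * x / (c + x)"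
  shows "bernstein_function g"
proof -
  \<comment> \<open>\<open>D k\<close> is the k-th derivative of \<open>D 0\<close>, which is the
    derivative of \<open>g\<close>.\<close>
  define D where "D k x = (-1) ^ k * (fact k / (c + x) ^ Suc k + K * c * fact (Suc k) / (c + x) ^ Suc (Suc k))"
    for k :: nat and x :: real
  have D_deriv: "DERIV (D k) x :> D (Suc k) x" if "x > 0" for k x
  proof -
    have cx: "c + x \<noteq> 0" using c that by simp
    have pw: "DERIV (\<lambda>x. A / (c + x) ^ Suc n) x :> - (A * of_nat (Suc n) / (c + x) ^ Suc (Suc n))" for A n
    proof -
      have "DERIV (\<lambda>x. inverse (c + x)) x :> - (inverse (c + x))\<^sup>2"
        using cx by (auto intro!: derivative_eq_intros simp: power2_eq_square)
      from DERIV_cmult[OF DERIV_power[OF this, of "Suc n"], of A] show ?thesis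
        by (simp add: divide_inverse power2_eq_square mult_ac power_inverse[symmetric] del: power_inverse)
    qed
    have neg: "(-1) ^ k * (- A + - B) = (-1) ^ Suc k * (A + B)" for A B :: real
      by (simp add: algebra_simps)
    have "DERIV (D k) x :> (-1) ^ k * (- (fact k * of_nat (Suc k) / (c + x) ^ Suc (Suc k)) +
        - (K * c * fact (Suc k) * of_nat (Suc (Suc k)) / (c + x) ^ Suc (Suc (Suc k))))"
      unfolding D_def by (intro DERIV_cmult DERIV_add pw)
    moreover have "(-1) ^ k * (- (fact k * of_nat (Suc k) / (c + x) ^ Suc (Suc k)) +
        - (K * c * fact (Suc k) * of_nat (Suc (Suc k)) / (c + x) ^ Suc (Suc (Suc k)))) = D (Suc k) x"
      unfolding D_def neg fact_Suc[of "Suc k"] fact_Suc[of k] by (simp only: mult_ac)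
    ultimately show ?thesis by (simp only:)
  qed
  \<comment> \<open>The formulas for \<open>g\<close> and its derivatives hold only at positive
    arguments; openness of that set lets them be differentiated there.\<close>
  have ev: "\<forall>\<^sub>F y in nhds x. 0 < y" if "x > 0" for x :: real
    using that by (intro eventually_nhds_in_open[of "{0<..}", simplified]) auto
  have g_deriv: "DERIV g x :> D 0 x" if "x > 0" for x
  proof -
    have cx: "c + x > 0" using c that by simp
    have "DERIV (\<lambda>x. ln ((c + x) / c) + K * x / (c + x)) x :> D 0 x"
    proof (rule DERIV_cong)
      show "DERIV (\<lambda>x. ln ((c + x) / c) + K * x / (c + x)) x :>
          1 / c / ((c + x) / c) + (K * (c + x) - K * x) / ((c + x) * (c + x))"
        using c cx by (auto intro!: derivative_eq_intros)
      show "1 / c / ((c + x) / c) + (K * (c + x) - K * x) / ((c + x) * (c + x)) = D 0 x"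
        unfolding D_def using c cx by (simp add: algebra_simps)
    qed
    then show ?thesis
      by (rule DERIV_cong_ev[THEN iffD2, rotated -1])
         (use eventually_mono[OF ev[OF that] g] in auto)
  qed
  have iter: "(deriv ^^ k) (deriv g) x = D k x" if "x > 0" for k x
    using that
  proof (induction k arbitrary: x)
    case 0
    then show ?case using g_deriv DERIV_imp_deriv by auto
  next
    case (Suc k)
    have "deriv ((deriv ^^ k) (deriv g)) x = deriv (D k) x"
      by (rule deriv_cong_ev[OF eventually_mono[OF ev[OF Suc.prems] Suc.IH]]) auto
    then show ?case using D_deriv[OF Suc.prems] DERIV_imp_deriv by auto
  qed
  have "(deriv ^^ k) (deriv g) differentiable (at x)" if "x > 0" for k x
  proof -
    have "DERIV ((deriv ^^ k) (deriv g)) x :> D (Suc k) x"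
      using D_deriv[OF that]
      by (rule DERIV_cong_ev[THEN iffD2, rotated -1])
         (use eventually_mono[OF ev[OF that] iter] in auto)
    then show ?thesis using real_differentiable_def by blast
  qed
  moreover have "(-1) ^ k * (deriv ^^ k) (deriv g) x \<ge> 0" if "x > 0" for k x
    unfolding iter[OF that] D_def using c K that
    by (simp flip: mult.assoc power_mult_distrib)
  moreover have "g x \<ge> 0" if "x > 0" for x
    unfolding g[OF that] using c K that
    by (intro add_nonneg_nonneg ln_ge_zero divide_nonneg_nonneg) auto
  ultimately show ?thesis
    unfolding bernstein_function_def completely_monotone_def
    using g_deriv real_differentiable_def by blast
qed

section \<open>Infinite divisibility\<close>

lemma infinitely_divisible_rician:
  fixes c K :: real
  assumes M: "prob_space M" and X: "X \<in> borel_measurable M" and X0: "AE \<omega> in M. 0 \<le> X \<omega>"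
    and c: "c > 0" and K: "K \<ge> 0"
    and lap: "\<And>s. s \<ge> 0 \<Longrightarrow> laplace_transform M X s = c / (c + s) * exp (- (K * s / (c + s)))"
  shows "infinitely_divisible M X"
  unfolding infinitely_divisible_def
proof (intro allI impI)
  fix n :: nat
  assume n: "n \<ge> 1"
  \<comment> \<open>Shape \<open>1 / n\<close> and Poisson mean \<open>K / n\<close> make the n-th
    power of the transform that of \<open>X\<close>.\<close>
  obtain D where "prob_space D" and sD [measurable_cong]: "sets D = sets borel" and D0: "AE x in D. 0 \<le> x"
    and lapD: "\<And>s. s \<ge> 0 \<Longrightarrow> laplace_transform D (\<lambda>x. x) s
      = (c / (c + s)) powr (1 / n) * exp (- (K / n * s / (c + s)))"
    using ex_gamma_poisson_mixture[of "1 / n" c "K / n"] n c K by auto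
  interpret D: prob_space D by fact
  \<comment> \<open>The summands are the coordinates on the product of \<open>n\<close> copies of
    \<open>D\<close>, whose points are functions on the naturals, \<open>undefined\<close> from
    \<open>n\<close> on.\<close>
  define N where "N = Pi\<^sub>M {..<n} (\<lambda>_. D)"
  define Y where "Y i \<omega> = \<omega> i" for i :: nat and \<omega> :: "nat \<Rightarrow> real"
  interpret N: prob_space N unfolding N_def by (intro prob_space_PiM D.prob_space_axioms)
  have Y_meas [measurable]: "Y i \<in> borel_measurable N" if "i < n" for i
    using measurable_component_singleton[of i "{..<n}" "\<lambda>_. D"] that
    unfolding Y_def N_def by (simp add: measurable_cong_sets[OF refl sD])
  have distY: "distr N borel (Y i) = D" if "i < n" for i
  proof -
    have "distr N borel (Y i) = distr N D (Y i)" by (rule distr_cong) (auto simp: sD)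
    also have "\<dots> = D"
      unfolding N_def Y_def by (intro distr_PiM_component D.prob_space_axioms) (simp add: that)
    finally show ?thesis .
  qed
  \<comment> \<open>Independence means that the joint law is the product of the marginals.
    Restricting to the indices below \<open>n\<close> is the identity on the space of
    \<open>N\<close>, so the joint law is \<open>N\<close> itself.\<close>
  have indep: "N.indep_vars (\<lambda>_. borel) Y {..<n}"
  proof (subst N.indep_vars_iff_distr_eq_PiM')
    show "{..<n} \<noteq> {}" using n by (auto simp: lessThan_empty_iff)
    have "distr N (Pi\<^sub>M {..<n} (\<lambda>_. borel)) (\<lambda>x. \<lambda>i\<in>{..<n}. Y i x) = distr N N (\<lambda>x. x)"
    proof (rule distr_cong)
      show "sets (Pi\<^sub>M {..<n} (\<lambda>_. borel)) = sets N"
        unfolding N_def by (intro sets_PiM_cong) (auto simp: sD)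
      show "(\<lambda>i\<in>{..<n}. Y i x) = x" if "x \<in> space N" for x
        using that unfolding N_def Y_def space_PiM by (auto simp: PiE_iff extensional_def fun_eq_iff)
    qed simp
    also have "\<dots> = N" by simp
    also have "\<dots> = Pi\<^sub>M {..<n} (\<lambda>i. distr N borel (Y i))"
      unfolding N_def[symmetric] by (subst N_def, rule PiM_cong) (auto simp: distY)
    finally show "distr N (Pi\<^sub>M {..<n} (\<lambda>_. borel)) (\<lambda>x. \<lambda>i\<in>{..<n}. Y i x)
        = Pi\<^sub>M {..<n} (\<lambda>i. distr N borel (Y i))" .
  qed auto
  have Y0: "AE \<omega> in N. \<forall>i\<in>{..<n}. 0 \<le> Y i \<omega>"
  proof (rule AE_finite_allI)
    fix i assume "i \<in> {..<n}"
    then show "AE \<omega> in N. 0 \<le> Y i \<omega>"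
      unfolding N_def Y_def using D0 D.prob_space_axioms by (intro AE_PiM_component) auto
  qed simp
  have "distr M borel X = distr N borel (\<lambda>\<omega>. \<Sum>i<n. Y i \<omega>)"
  proof (rule distr_eq_if_laplace_transform_eq[OF M N.prob_space_axioms X])
    show "(\<lambda>\<omega>. \<Sum>i<n. Y i \<omega>) \<in> borel_measurable N" by measurable
    show "AE \<omega> in N. 0 \<le> (\<Sum>i<n. Y i \<omega>)"
      using Y0 by eventually_elim (auto intro: sum_nonneg)
    fix k :: nat
    define s where "s = real k"
    have s: "s \<ge> 0" by (simp add: s_def)
    have lapY: "(\<integral>\<omega>. exp (- s * Y i \<omega>) \<partial>N) = (c / (c + s)) powr (1 / n) * exp (- (K / n * s / (c + s)))"
      if "i < n" for i
    proof -
      have "(\<integral>\<omega>. exp (- s * Y i \<omega>) \<partial>N) = (\<integral>x. exp (- s * x) \<partial>distr N borel (Y i))"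
        using that by (subst integral_distr) auto
      then show ?thesis
        using lapD[OF s] that by (simp add: distY laplace_transform_def)
    qed
    have int: "integrable N (\<lambda>\<omega>. exp (- s * Y i \<omega>))" if "i < n" for i
      by (rule N.integrable_const_bound[of _ 1]) (use Y0 s that in auto)
    have "laplace_transform N (\<lambda>\<omega>. \<Sum>i<n. Y i \<omega>) s = (\<integral>\<omega>. (\<Prod>i<n. exp (- s * Y i \<omega>)) \<partial>N)"
      unfolding laplace_transform_def by (simp add: sum_distrib_left exp_sum flip: sum_negf)
    also have "\<dots> = (\<Prod>i<n. \<integral>\<omega>. exp (- s * Y i \<omega>) \<partial>N)"
      by (rule N.indep_vars_lebesgue_integral)
         (use int in \<open>auto intro!: N.indep_vars_compose2[OF indep]\<close>)
    also have "\<dots> = ((c / (c + s)) powr (1 / n) * exp (- (K / n * s / (c + s)))) ^ n"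
      by (subst prod.cong[OF refl lapY]) auto
    also have "\<dots> = c / (c + s) * exp (- (K * s / (c + s)))"
      using c s n by (simp add: power_mult_distrib powr_power flip: exp_of_nat_mult)
    also have "\<dots> = laplace_transform M X s" using lap[OF s] by simp
    finally show "laplace_transform M X k = laplace_transform N (\<lambda>\<omega>. \<Sum>i<n. Y i \<omega>) k"
      by (simp add: s_def)
  qed fact
  then show "\<exists>(N :: (nat \<Rightarrow> real) measure) (Y :: nat \<Rightarrow> (nat \<Rightarrow> real) \<Rightarrow> real).
          prob_space N \<and>
          prob_space.indep_vars N (\<lambda>_. borel) Y {..<n} \<and>
          (\<forall>i<n. \<forall>j<n. distr N borel (Y i) = distr N borel (Y j)) \<and>
          distr M borel X = distr N borel (\<lambda>\<omega>. \<Sum>i<n. Y i \<omega>)"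
    using N.prob_space_axioms indep distY by (intro exI[of _ N] exI[of _ Y]) auto
qed

section \<open>Assembly with \<open>c = 1 + K\<close>\<close>

text \<open>The last claim is restricted to \<open>K > 0\<close>: for \<open>K = 0\<close> the law
  is exponential with rate 1, a GGC whose measure is the unit mass at 1.\<close>

theorem mainTheorem1:
  fixes M :: "'a measure" and X :: "'a \<Rightarrow> real" and K :: real and \<tau> :: "real \<Rightarrow> real"
  assumes "prob_space M"
    and "X \<in> borel_measurable M"
    and "AE \<omega> in M. X \<omega> \<ge> 0"
    and "K \<ge> 0"
    and "\<And>s. s \<ge> 0 \<Longrightarrow>
           laplace_transform M X s = (1 + K) / (1 + K + s) * exp (- (K * s / (1 + K + s)))"
    and "\<And>s. \<tau> s = exp (- (1 + K) * s) * (K * (1 + K) + 1 / s)"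
  shows "bernstein_function (laplace_exponent M X)
       \<and> (\<forall>x\<ge>0. set_integrable lborel {0<..} (\<lambda>s. (1 - exp (- s * x)) * \<tau> s) \<and>
            laplace_exponent M X x = (LINT s:{0<..}|lborel. (1 - exp (- s * x)) * \<tau> s))
       \<and> infinitely_divisible M X
       \<and> (K > 0 \<longrightarrow> \<not> generalized_gamma_convolution M X)"
proof (intro conjI allI impI)
  have c: "1 + K > 0" using assms(4) by simp
  have lap: "laplace_transform M X s = exp (- (ln ((1 + K + s) / (1 + K)) + K * s / (1 + K + s)))"
    if "s \<ge> 0" for s
    using assms(5)[OF that] c that by (simp add: exp_add exp_diff exp_minus divide_inverse)
  have expo: "laplace_exponent M X x = ln ((1 + K + x) / (1 + K)) + K * x / (1 + K + x)" if "x \<ge> 0" for x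
    using lap[OF that] by (simp add: laplace_exponent_def)
  show "bernstein_function (laplace_exponent M X)"
    by (rule bernstein_function_rician_exponent[OF c assms(4)]) (simp add: expo)
  show "infinitely_divisible M X"
    by (rule infinitely_divisible_rician[OF assms(1-3) c assms(4,5)])
  show "\<not> generalized_gamma_convolution M X" if "K > 0"
    by (rule not_generalized_gamma_convolution_if[OF c that lap])
  fix x :: real
  assume x: "x \<ge> 0"
  have "has_bochner_integral lborel (\<lambda>s. indicator {0<..} s *\<^sub>R ((1 - exp (- s * x)) * \<tau> s))
      (laplace_exponent M X x)"
    using rician_exponent_integral[OF c assms(4) x] by (simp add: expo[OF x] assms(6))
  then show "set_integrable lborel {0<..} (\<lambda>s. (1 - exp (- s * x)) * \<tau> s)"
    and "laplace_exponent M X x = (LINT s:{0<..}|lborel. (1 - exp (- s * x)) * \<tau> s)"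
    unfolding set_integrable_def set_lebesgue_integral_def
    by (auto simp: has_bochner_integral_iff)
qed

end
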